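(* Let $\mathcal{F}=\mathbb{C}\langle x_1,\dots,x_n,x_1^*,\dots,x_n^*\rangle$ be a free $*$-algebra and let $k\ge2$. Every tip-maximal functional $L_{k-1}\in V_{2k-2}^*$ on $\mathcal{F}$ can be extended to a flat functional $L_k\in V_{2k}^*$. Moreover, if $L_{k-1}$ is positive semidefinite then so is $L_k$.
   Context: $\mathcal{F}$ is the free unital complex associative algebra on the letters $x_1,\dots,x_n,x_1^*,\dots,x_n^*$, with the conjugate-linear anti-multiplicative involution exchanging $x_i$ and $x_i^*$. Its basis $\mathcal{B}$ consists of all words in these letters, including the empty word $1$; $|a|$ is the length of the word $a$. For $k\ge 0$ put $S_k=\{a\in\mathcal{B}:|a|\le k\}$, $V_k=\operatorname{Span}(S_k)$, and let $V_k^*$ be the dual space of $V_k$. For $L_k\in V_{2k}^*$ define $B_{L_k}\colon V_k\times V_k\to\mathbb{C}$ by $B_{L_k}(p,q)=L_k(pq^* )$, $\ker B_{L_k}=\{p\in V_k: B_{L_k}(p,q)=0\ \text{for all } q\in V_k\}$, and $\operatorname{rank}B_{L_k}=\dim V_k/\ker B_{L_k}$. $L_k$ is hermitian if $L_k(a^* )=\overline{L_k(a)}$ for all $a\in V_{2k}$, and positive semidefinite if $L_k(pp^* )\ge0$ for all $p\in V_k$. For $k>1$, $L_k\in V_{2k}^*$ is called flat if it is hermitian and $\operatorname{rank}B_{L_k}=\operatorname{rank}B_{L_{k-1}}$, where $L_{k-1}$ is the restriction of $L_k$ to $V_{2k-2}$. For $m\ge1$, a hermitian functional $L_m\in V_{2m}^*$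 is called tip-maximal if there is a set $p_1,\dots,p_r$ spanning $\ker B_{L_m}$ such that the projections $f_1,\dots,f_r$ of $p_1,\dots,p_r$ onto $\operatorname{Span}(S_m\setminus S_{m-1})$ parallel to $\operatorname{Span}(S_{m-1})$ are linearly independent (in particular, $L_m$ is tip-maximal if $B_{L_m}$ is non-degenerate, the case $r=0$). *)

theory Defs
  imports Complex_Main "HOL-Library.FuncSet" "HOL-Library.Poly_Mapping" "HOL-Library.Nonpos_Ints"
begin

text \<open>
  The free star-algebra over \<^typ>\<open>complex\<close> is the monoid algebra of the words over the letters
  \<open>x\<^sub>i, x\<^sub>i\<^sup>*\<close>, with \<open>i\<close> ranging over a type \<open>'n\<close> (a finite one with \<open>n\<close> elements in applications).
  The product of \<^theory>\<open>HOL-Library.Poly_Mapping\<close> convolves along \<open>+\<close> of the index type, so the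
  concatenation of words is written additively and the empty word is \<open>0\<close>.
\<close>

datatype 'n letter = X 'n | Xstar 'n

datatype 'n nc_word = Word (letters: "'n letter list")

instantiation nc_word :: (type) monoid_add
begin

definition zero_nc_word :: "'a nc_word" where
  "0 = Word []"

definition plus_nc_word :: "'a nc_word \<Rightarrow> 'a nc_word \<Rightarrow> 'a nc_word" where
  "u + v = Word (letters u @ letters v)"

instance
  by standard (simp_all add: zero_nc_word_def plus_nc_word_def)

end

type_synonym 'n nc_poly = "'n nc_word \<Rightarrow>\<^sub>0 complex"

definition nc_scale :: "complex \<Rightarrow> 'n nc_poly \<Rightarrow> 'n nc_poly" where
  "nc_scale c p = Poly_Mapping.map ((*) c) p"

lemma lookup_nc_scale [simp]: "Poly_Mapping.lookup (nc_scale c p) w = c * Poly_Mapping.lookup p w"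
  by (simp add: nc_scale_def Poly_Mapping.map.rep_eq when_def)

global_interpretation nc: vector_space nc_scale
  by standard (auto intro!: poly_mapping_eqI simp: lookup_add algebra_simps)

primrec letter_star :: "'n letter \<Rightarrow> 'n letter" where
  "letter_star (X i) = Xstar i"
| "letter_star (Xstar i) = X i"

definition word_star :: "'n nc_word \<Rightarrow> 'n nc_word" where
  "word_star w = Word (rev (map letter_star (letters w)))"

text \<open>The coefficient of \<open>p\<^sup>*\<close> at \<open>w\<close> is the conjugate of the coefficient of \<open>p\<close> at \<open>w\<^sup>*\<close>.\<close>

definition nc_star :: "'n nc_poly \<Rightarrow> 'n nc_poly" where
  "nc_star p = Poly_Mapping.map cnj (Poly_Mapping.map_key word_star p)"

definition S_deg :: "nat \<Rightarrow> 'n nc_poly set" where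
  "S_deg k = {Poly_Mapping.single w 1 | w. length (letters w) \<le> k}"

definition V_deg :: "nat \<Rightarrow> 'n nc_poly set" where
  "V_deg k = nc.span (S_deg k)"

text \<open>
  A functional on \<open>V_deg d\<close> is an extensional function, so that equality of functionals is
  equality of their values on \<open>V_deg d\<close>.
\<close>

definition dual_deg :: "nat \<Rightarrow> ('n nc_poly \<Rightarrow> complex) set" where
  "dual_deg d = {L \<in> extensional (V_deg d).
     (\<forall>p\<in>V_deg d. \<forall>q\<in>V_deg d. L (p + q) = L p + L q) \<and>
     (\<forall>c. \<forall>p\<in>V_deg d. L (nc_scale c p) = c * L p)}"

definition B_form :: "('n nc_poly \<Rightarrow> complex) \<Rightarrow> 'n nc_poly \<Rightarrow> 'n nc_poly \<Rightarrow> complex" where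
  "B_form L p q = L (p * nc_star q)"

definition ker_B :: "nat \<Rightarrow> ('n nc_poly \<Rightarrow> complex) \<Rightarrow> 'n nc_poly set" where
  "ker_B k L = {p \<in> V_deg k. \<forall>q\<in>V_deg k. B_form L p q = 0}"

definition coset :: "'n nc_poly set \<Rightarrow> 'n nc_poly \<Rightarrow> 'n nc_poly set" where
  "coset W p = {p + w | w. w \<in> W}"

definition quot_space :: "'n nc_poly set \<Rightarrow> 'n nc_poly set \<Rightarrow> 'n nc_poly set set" where
  "quot_space V W = {coset W p | p. p \<in> V}"

text \<open>
  For cosets \<open>P\<close> and \<open>Q\<close> of \<open>W\<close>, the set \<open>{nc_scale c p + q | p q. p \<in> P \<and> q \<in> Q}\<close> is the coset
  \<open>c \<cdot> P + Q\<close>. The zero of the quotient is \<open>W\<close>.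
\<close>

inductive_set quot_span :: "'n nc_poly set \<Rightarrow> 'n nc_poly set set \<Rightarrow> 'n nc_poly set set"
  for W :: "'n nc_poly set" and C :: "'n nc_poly set set" where
  zero: "W \<in> quot_span W C"
| step: "P \<in> C \<Longrightarrow> Q \<in> quot_span W C \<Longrightarrow> {nc_scale c p + q | p q. p \<in> P \<and> q \<in> Q} \<in> quot_span W C"

text \<open>The dimension of \<open>V/W\<close>, meaningful when the quotient is finite-dimensional.\<close>

definition quot_dim :: "'n nc_poly set \<Rightarrow> 'n nc_poly set \<Rightarrow> nat" where
  "quot_dim V W =
     (LEAST d. \<exists>C \<subseteq> quot_space V W. finite C \<and> card C = d \<and> quot_span W C = quot_space V W)"

definition rank_B :: "nat \<Rightarrow> ('n nc_poly \<Rightarrow> complex) \<Rightarrow> nat" where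
  "rank_B k L = quot_dim (V_deg k) (ker_B k L)"

text \<open>The predicates below carry the index \<open>k\<close> for a functional on \<open>V_deg (2 * k)\<close>.\<close>

definition hermitian :: "nat \<Rightarrow> ('n nc_poly \<Rightarrow> complex) \<Rightarrow> bool" where
  "hermitian k L \<longleftrightarrow> (\<forall>a\<in>V_deg (2 * k). L (nc_star a) = cnj (L a))"

definition positive_semidefinite :: "nat \<Rightarrow> ('n nc_poly \<Rightarrow> complex) \<Rightarrow> bool" where
  "positive_semidefinite k L \<longleftrightarrow> (\<forall>p\<in>V_deg k. L (p * nc_star p) \<in> \<real>\<^sub>\<ge>\<^sub>0)"

definition flat :: "nat \<Rightarrow> ('n nc_poly \<Rightarrow> complex) \<Rightarrow> bool" where
  "flat k L \<longleftrightarrow> 1 < k \<and> L \<in> dual_deg (2 * k) \<and> hermitian k L \<and>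
     rank_B k L = rank_B (k - 1) (restrict L (V_deg (2 * k - 2)))"

text \<open>The projection onto \<open>A\<close> parallel to \<open>B\<close>, meaningful on \<open>A \<oplus> B\<close>.\<close>

definition proj_along :: "'n nc_poly set \<Rightarrow> 'n nc_poly set \<Rightarrow> 'n nc_poly \<Rightarrow> 'n nc_poly" where
  "proj_along A B p = (THE f. f \<in> A \<and> p - f \<in> B)"

definition tip :: "nat \<Rightarrow> 'n nc_poly \<Rightarrow> 'n nc_poly" where
  "tip m = proj_along (nc.span (S_deg m - S_deg (m - 1))) (nc.span (S_deg (m - 1)))"

text \<open>
  Linear independence of the family \<open>f\<^sub>1, \<dots>, f\<^sub>r\<close> of projections amounts to injectivity of the
  projection on \<open>{p\<^sub>1, \<dots>, p\<^sub>r}\<close> together with independence of the image.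
\<close>

definition tip_maximal :: "nat \<Rightarrow> ('n nc_poly \<Rightarrow> complex) \<Rightarrow> bool" where
  "tip_maximal m L \<longleftrightarrow> 1 \<le> m \<and> L \<in> dual_deg (2 * m) \<and> hermitian m L \<and>
     (\<exists>P. finite P \<and> nc.span P = ker_B m L \<and> inj_on (tip m) P \<and> nc.independent (tip m ` P))"


subsection \<open>Adequacy of the definitions\<close>

lemma letter_star_letter_star [simp]: "letter_star (letter_star l) = l"
  by (cases l) auto

lemma word_star_word_star [simp]: "word_star (word_star w) = w"
  by (cases w) (simp add: word_star_def rev_map o_def)

lemma word_star_plus: "word_star (u + v) = word_star v + word_star u"
  by (simp add: word_star_def plus_nc_word_def)

lemma inj_word_star: "inj word_star"
  by (metis injI word_star_word_star)

lemma lookup_nc_star [simp]: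
  "Poly_Mapping.lookup (nc_star p) w = cnj (Poly_Mapping.lookup p (word_star w))"
  by (simp add: nc_star_def Poly_Mapping.map.rep_eq map_key.rep_eq inj_word_star when_def)

lemma nc_star_nc_star [simp]: "nc_star (nc_star p) = p"
  by (rule poly_mapping_eqI) simp

lemma nc_star_add: "nc_star (p + q) = nc_star p + nc_star q"
  by (rule poly_mapping_eqI) (simp add: lookup_add)

lemma nc_star_scale: "nc_star (nc_scale c p) = nc_scale (cnj c) (nc_star p)"
  by (rule poly_mapping_eqI) simp

lemma nc_star_single:
  "nc_star (Poly_Mapping.single w c) = Poly_Mapping.single (word_star w) (cnj c)"
  by (rule poly_mapping_eqI) (auto simp: lookup_single when_def)

lemma nc_star_zero [simp]: "nc_star 0 = 0"
  by (rule poly_mapping_eqI) simp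

lemma nc_star_mult: "nc_star (p * q) = nc_star q * nc_star p"
proof (induction p rule: update_induct)
  case const
  show ?case by simp
next
  case (update p a b)
  have up: "Poly_Mapping.update a b p = Poly_Mapping.single a b + p"
    using update(1) by (intro poly_mapping_eqI)
      (auto simp: lookup_update lookup_add lookup_single when_def in_keys_iff)
  have one: "nc_star (Poly_Mapping.single a b * q) = nc_star q * nc_star (Poly_Mapping.single a b)"
  proof (induction q rule: update_induct)
    case const
    show ?case by simp
  next
    case (update q c d)
    have "Poly_Mapping.update c d q = Poly_Mapping.single c d + q"
      using update(1) by (intro poly_mapping_eqI)
        (auto simp: lookup_update lookup_add lookup_single when_def in_keys_iff)
    then show ?case
      using update(3) by (simp add: distrib_left distrib_right nc_star_add mult_single
          nc_star_single word_star_plus mult.commute)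
  qed
  show ?case
    using update(3) one by (simp add: up distrib_left distrib_right nc_star_add)
qed

lemma span_singles:
  "nc.span ((\<lambda>w. Poly_Mapping.single w 1) ` A) = {p. Poly_Mapping.keys p \<subseteq> A}"
proof (intro equalityI subsetI)
  fix p assume "p \<in> nc.span ((\<lambda>w. Poly_Mapping.single w (1::complex)) ` A)"
  then show "p \<in> {p. Poly_Mapping.keys p \<subseteq> A}"
  proof (induction rule: nc.span_induct_alt)
    case base
    show ?case by simp
  next
    case (step c x y)
    then show ?case
      by (auto simp: in_keys_iff lookup_add lookup_single when_def split: if_splits)
  qed
next
  fix p :: "'a nc_poly" assume "p \<in> {p. Poly_Mapping.keys p \<subseteq> A}"
  then show "p \<in> nc.span ((\<lambda>w. Poly_Mapping.single w 1) ` A)"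
  proof (induction p rule: update_induct)
    case const
    show ?case by (simp add: nc.span_zero)
  next
    case (update p a b)
    have up: "Poly_Mapping.update a b p = nc_scale b (Poly_Mapping.single a 1) + p"
      using update(1) by (intro poly_mapping_eqI)
        (auto simp: lookup_update lookup_add lookup_single when_def in_keys_iff)
    have "a \<in> A" "Poly_Mapping.keys p \<subseteq> A"
      using update by (auto simp: keys_update)
    then show ?case
      unfolding up using update(3)
      by (intro nc.span_add nc.span_scale) (auto intro: nc.span_base)
  qed
qed

lemma V_deg_eq: "V_deg k = {p :: 'n nc_poly. \<forall>w\<in>Poly_Mapping.keys p. length (letters w) \<le> k}"
proof -
  have "S_deg k = (\<lambda>w :: 'n nc_word. Poly_Mapping.single w 1) ` {w. length (letters w) \<le> k}"
    by (auto simp: S_deg_def)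
  then show ?thesis unfolding V_deg_def by (auto simp: span_singles)
qed

lemma lookup_tip:
  fixes p :: "'n nc_poly"
  assumes "1 \<le> m" "p \<in> V_deg m"
  shows "Poly_Mapping.lookup (tip m p) w = (if length (letters w) = m then Poly_Mapping.lookup p w else 0)"
proof -
  define A where "A = {w::'n nc_word. length (letters w) = m}"
  define B where "B = {w::'n nc_word. length (letters w) \<le> m - 1}"
  have SA: "S_deg m - S_deg (m - 1) = (\<lambda>w. Poly_Mapping.single w 1) ` A"
  proof -
    have inj: "inj (\<lambda>w :: 'n nc_word. Poly_Mapping.single w (1 :: complex))"
      by (rule injI) (metis keys_single singleton_inject zero_neq_one)
    have S: "S_deg j = (\<lambda>w. Poly_Mapping.single w 1) ` {w :: 'n nc_word. length (letters w) \<le> j}" for j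
      by (auto simp: S_deg_def)
    have "A = {w. length (letters w) \<le> m} - {w. length (letters w) \<le> m - 1}"
      using assms(1) by (auto simp: A_def)
    then show ?thesis by (simp add: S image_set_diff[OF inj])
  qed
  have SB: "S_deg (m - 1) = (\<lambda>w. Poly_Mapping.single w 1) ` B"
    by (auto simp: S_deg_def B_def)
  have ex: "\<exists>f. \<forall>w. Poly_Mapping.lookup f w = (if w \<in> A then Poly_Mapping.lookup p w else 0)"
  proof -
    have "finite {w. (if w \<in> A then Poly_Mapping.lookup p w else 0) \<noteq> 0}"
      by (rule finite_subset[OF _ finite_keys[of p]]) (auto simp: in_keys_iff)
    from lookup_Abs_poly_mapping[OF this] show ?thesis by (metis (lifting))
  qed
  then obtain f where f: "\<And>w. Poly_Mapping.lookup f w = (if w \<in> A then Poly_Mapping.lookup p w else 0)"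
    by blast
  have iff: "g \<in> nc.span (S_deg m - S_deg (m - 1)) \<and> p - g \<in> nc.span (S_deg (m - 1)) \<longleftrightarrow> g = f" for g
  proof -
    have "Poly_Mapping.keys g \<subseteq> A \<and> Poly_Mapping.keys (p - g) \<subseteq> B \<longleftrightarrow> g = f"
    proof
      assume *: "Poly_Mapping.keys g \<subseteq> A \<and> Poly_Mapping.keys (p - g) \<subseteq> B"
      have "A \<inter> B = {}" using assms(1) by (auto simp: A_def B_def)
      show "g = f"
      proof (rule poly_mapping_eqI)
        fix w show "Poly_Mapping.lookup g w = Poly_Mapping.lookup f w"
        proof (cases "w \<in> A")
          case True
          then have "w \<notin> Poly_Mapping.keys (p - g)" using * \<open>A \<inter> B = {}\<close> by blast
          then show ?thesis using True by (simp add: f in_keys_iff lookup_minus)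
        next
          case False
          then have "w \<notin> Poly_Mapping.keys g" using * by blast
          then show ?thesis using False by (simp add: f in_keys_iff)
        qed
      qed
    next
      assume g: "g = f"
      have "length (letters w) \<le> m" if "Poly_Mapping.lookup p w \<noteq> 0" for w
        using assms(2) that by (auto simp: V_deg_eq in_keys_iff)
      then show "Poly_Mapping.keys g \<subseteq> A \<and> Poly_Mapping.keys (p - g) \<subseteq> B"
        unfolding g by (force simp: f A_def B_def in_keys_iff lookup_minus split: if_splits)
    qed
    then show ?thesis unfolding SA unfolding SB by (simp add: span_singles)
  qed
  have "tip m p = f"
    unfolding tip_def proj_along_def iff by simp
  then show ?thesis by (simp add: f A_def)
qed

lemma quot_span_cosets:
  assumes W: "nc.subspace W"
  shows "quot_span W (coset W ` A) = coset W ` nc.span A"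
proof -
  have coset0: "coset W 0 = W" by (simp add: coset_def)
  have lin: "{nc_scale c p + q | p q. p \<in> coset W a \<and> q \<in> coset W b} = coset W (nc_scale c a + b)"
    for a b c
  proof (intro equalityI subsetI)
    fix z assume "z \<in> {nc_scale c p + q | p q. p \<in> coset W a \<and> q \<in> coset W b}"
    then obtain u v where "u \<in> W" "v \<in> W" "z = nc_scale c (a + u) + (b + v)"
      by (auto simp: coset_def)
    then have "z = (nc_scale c a + b) + (nc_scale c u + v)" "nc_scale c u + v \<in> W"
      using W by (auto simp: nc.scale_right_distrib algebra_simps
          intro: nc.subspace_add nc.subspace_scale)
    then show "z \<in> coset W (nc_scale c a + b)" by (auto simp: coset_def)
  next
    fix z assume "z \<in> coset W (nc_scale c a + b)"
    then obtain w where "w \<in> W" "z = nc_scale c a + (b + w)"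
      by (auto simp: coset_def algebra_simps)
    moreover from \<open>w \<in> W\<close> have "b + w \<in> coset W b"
      by (auto simp: coset_def)
    moreover have "a \<in> coset W a"
      using nc.subspace_0[OF W] by (force simp: coset_def)
    ultimately show "z \<in> {nc_scale c p + q | p q. p \<in> coset W a \<and> q \<in> coset W b}"
      by blast
  qed
  show ?thesis
  proof (intro equalityI subsetI)
    fix P assume "P \<in> quot_span W (coset W ` A)"
    then show "P \<in> coset W ` nc.span A"
    proof induction
      case zero
      show ?case using coset0 nc.span_zero by (metis image_eqI)
    next
      case (step P Q c)
      then obtain a b where "P = coset W a" "a \<in> A" "Q = coset W b" "b \<in> nc.span A" by auto
      moreover from this have "nc_scale c a + b \<in> nc.span A"
        by (simp add: nc.span_add nc.span_scale nc.span_base)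
      ultimately show ?case by (simp add: lin)
    qed
  next
    fix P assume "P \<in> coset W ` nc.span A"
    then obtain a where P: "P = coset W a" and "a \<in> nc.span A" by auto
    from this(2) have "coset W a \<in> quot_span W (coset W ` A)"
    proof (induction rule: nc.span_induct_alt)
      case base
      show ?case by (simp add: coset0 quot_span.zero)
    next
      case (step c x y)
      then show ?case using quot_span.step[of "coset W x" "coset W ` A" "coset W y" W c]
        by (simp add: lin)
    qed
    then show "P \<in> quot_span W (coset W ` A)" by (simp add: P)
  qed
qed

lemma quot_dim_eq:
  assumes V: "nc.subspace V" and W: "nc.subspace W" and WV: "W \<subseteq> V"
    and F: "finite F" "V \<subseteq> nc.span F"
  shows "quot_dim V W = nc.dim V - nc.dim W"
proof -
  obtain BW where BW: "BW \<subseteq> W" "nc.independent BW" "W \<subseteq> nc.span BW" "card BW = nc.dim W"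
    using nc.basis_exists[of W] by blast
  obtain BV where BV: "BW \<subseteq> BV" "BV \<subseteq> V" "nc.independent BV" "V \<subseteq> nc.span BV"
    using nc.maximal_independent_subset_extend[of BW V] BW WV by blast
  have finBV: "finite BV"
    using nc.independent_span_bound[OF F(1) BV(3)] BV(2) F(2) by blast
  then have finBW: "finite BW" using BV(1) finite_subset by blast
  have cardBV: "card BV = nc.dim V"
    using nc.basis_card_eq_dim[OF BV(2,4,3)] .
  let ?Q = "\<lambda>d. \<exists>C \<subseteq> quot_space V W. finite C \<and> card C = d \<and> quot_span W C = quot_space V W"
  have qs: "quot_space V W = coset W ` V" by (auto simp: quot_space_def)
  have spanW: "nc.span BW = W" using BW(1,3) nc.span_minimal[OF _ W] by blast
  have absorb: "coset W (p + w) = coset W p" if "w \<in> W" for p w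
  proof (intro equalityI subsetI)
    fix z assume "z \<in> coset W (p + w)"
    then obtain v where "v \<in> W" "z = p + (w + v)" by (auto simp: coset_def algebra_simps)
    then show "z \<in> coset W p" using that nc.subspace_add[OF W] by (auto simp: coset_def)
  next
    fix z assume "z \<in> coset W p"
    then obtain v where "v \<in> W" "z = (p + w) + (v - w)" by (auto simp: coset_def)
    then show "z \<in> coset W (p + w)" using that nc.subspace_diff[OF W] unfolding coset_def by blast
  qed
  define A where "A = BV - BW"
  have spanA: "coset W ` nc.span A = coset W ` V"
  proof (intro equalityI subsetI)
    fix P assume "P \<in> coset W ` nc.span A"
    moreover have "nc.span A \<subseteq> V" using BV(2) A_def by (intro nc.span_minimal[OF _ V]) auto
    ultimately show "P \<in> coset W ` V" by auto
  next
    fix P assume "P \<in> coset W ` V"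
    then obtain p where p: "p \<in> V" "P = coset W p" by auto
    have "p \<in> nc.span (A \<union> BW)" using p BV(1,4) by (auto simp: A_def Un_absorb2)
    then obtain a w where "p = a + w" "a \<in> nc.span A" "w \<in> W"
      by (auto simp: nc.span_Un spanW)
    then show "P \<in> coset W ` nc.span A" using absorb p by auto
  qed
  have "?Q (card (coset W ` A))"
    using BV(2) finBV spanA
    by (intro exI[of _ "coset W ` A"]) (auto simp: qs quot_span_cosets[OF W] A_def)
  then have ex: "?Q (quot_dim V W)" and le: "quot_dim V W \<le> card (coset W ` A)"
    unfolding quot_dim_def by (rule LeastI, rule Least_le)
  have "card (coset W ` A) \<le> card A" using finBV by (simp add: A_def card_image_le)
  also have "card A = nc.dim V - nc.dim W"
    using BV(1) finBW by (simp add: A_def card_Diff_subset cardBV BW(4))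
  finally have 1: "quot_dim V W \<le> nc.dim V - nc.dim W" using le by linarith
  obtain C where C: "C \<subseteq> quot_space V W" "finite C" "card C = quot_dim V W"
    "quot_span W C = quot_space V W" using ex by blast
  then obtain R where R: "R \<subseteq> V" "finite R" "inj_on (coset W) R" "C = coset W ` R"
    unfolding qs by (metis subset_image_inj finite_imageD)
  have "V \<subseteq> nc.span (R \<union> BW)"
  proof
    fix p assume "p \<in> V"
    then have "coset W p \<in> coset W ` nc.span R"
      using C(4) R(4) by (simp add: quot_span_cosets[OF W] qs)
    then obtain r where r: "r \<in> nc.span R" "coset W p = coset W r" by auto
    have "p \<in> coset W p" using nc.subspace_0[OF W] by (force simp: coset_def)
    then have "p \<in> coset W r" by (simp only: r(2))
    then obtain w where "w \<in> W" "p = r + w" by (auto simp: coset_def)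
    then show "p \<in> nc.span (R \<union> BW)" using r(1) by (auto simp: nc.span_Un spanW)
  qed
  then have "nc.dim V \<le> card (R \<union> BW)"
    using nc.dim_le_card R(2) finBW by (metis finite_UnI)
  also have "\<dots> \<le> card R + card BW" by (rule card_Un_le)
  also have "card R = quot_dim V W" using C(3) R(3,4) by (simp add: card_image)
  finally have "nc.dim V - nc.dim W \<le> quot_dim V W" using BW(4) by simp
  with 1 show ?thesis by simp
qed

end

theory Submission
  imports Defs
begin

text \<open>
  Put \<open>m = k - 1\<close>. Tip-maximality says that \<open>ker B\<^bsub>L\<^esub>\<close> meets \<open>V\<^bsub>m-1\<^esub>\<close> trivially, so there is a
  linear \<open>E\<close> on \<open>V\<^bsub>m\<^esub>\<close> that kills the kernel, fixes \<open>V\<^bsub>m-1\<^esub>\<close> and changes elements only by members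
  of the kernel. Replacing \<open>u\<close> and \<open>v\<close> by \<open>E u\<close> and \<open>E v\<close> yields consistent hermitian values for
  \<open>L(u x v\<^sup>*)\<close> in degree \<open>2m + 1\<close> that vanish whenever \<open>u\<close> or \<open>v\<close> lies in the kernel. Hence each word
  of length \<open>m + 1\<close> acts on \<open>V\<^bsub>m\<^esub>\<close> as some element of \<open>V\<^bsub>m\<^esub>\<close>, which defines a linear retraction
  \<open>\<phi> : V\<^bsub>m+1\<^esub> \<rightarrow> V\<^bsub>m\<^esub>\<close>. The form \<open>D(p, q) = L(\<phi>(p) \<phi>(q)\<^sup>*)\<close> satisfies \<open>D(u x, v) = D(u, v x\<^sup>*)\<close>, so it
  depends on \<open>p q\<^sup>*\<close> only and is the form of the required extension. Flatness and positivity are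
  then inherited through \<open>\<phi>\<close>.
\<close>

section \<open>Linear endomorphisms and linear functionals of the free algebra\<close>

interpretation nc_endo: vector_space_pair nc_scale nc_scale ..

lemma vector_space_field: "vector_space ((*) :: 'a::field \<Rightarrow> 'a \<Rightarrow> 'a)"
  by unfold_locales (auto simp: algebra_simps)

interpretation nc_dual: vector_space_pair nc_scale "(*) :: complex \<Rightarrow> complex \<Rightarrow> complex"
  by (rule vector_space_pair.intro[OF nc.vector_space_axioms vector_space_field])

lemma linear_functional_iff:
  "Vector_Spaces.linear nc_scale (*) f \<longleftrightarrow>
     (\<forall>p q. f (p + q) = f p + f q) \<and> (\<forall>c p. f (nc_scale c p) = c * f p)"
  by (simp add: Vector_Spaces.linear_iff nc.vector_space_axioms vector_space_field)

lemma linear_endo_iff: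
  "Vector_Spaces.linear nc_scale nc_scale f \<longleftrightarrow>
     (\<forall>p q. f (p + q) = f p + f q) \<and> (\<forall>c p. f (nc_scale c p) = nc_scale c (f p))"
  by (simp add: Vector_Spaces.linear_iff nc.vector_space_axioms)

section \<open>Functionals and quotient dimensions\<close>

text \<open>Induction on \<open>I\<close> with \<open>V\<close> varying: on the kernel of
  \<open>f j\<close> in \<open>V\<close> the remaining functionals already determine
  \<open>g\<close>, and a multiple of \<open>f j\<close> accounts for one further direction.\<close>

lemma functional_combination:
  fixes f :: "'i \<Rightarrow> 'n nc_poly \<Rightarrow> complex"
  assumes "finite I" and "\<And>i. Vector_Spaces.linear nc_scale (*) (f i)"
    and "Vector_Spaces.linear nc_scale (*) g" and "nc.subspace V"
    and "\<And>x. x \<in> V \<Longrightarrow> (\<And>i. i \<in> I \<Longrightarrow> f i x = 0) \<Longrightarrow> g x = 0"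
  shows "\<exists>c. \<forall>x\<in>V. g x = (\<Sum>i\<in>I. c i * f i x)"
  using assms
proof (induction I arbitrary: V rule: finite_induct)
  case empty
  then show ?case by simp
next
  case (insert j I)
  have f: "f i (p + q) = f i p + f i q" "f i (nc_scale c p) = c * f i p" for i p q c
    using insert.prems(1) by (auto simp: linear_functional_iff)
  have g: "g (p - q) = g p - g q" "g (nc_scale c p) = c * g p" for p q c
    using insert.prems(2) by (auto simp: nc_dual.linear_diff nc_dual.linear_scale)
  have fdiff: "f i (p - q) = f i p - f i q" for i p q
    using insert.prems(1) by (rule nc_dual.linear_diff)
  have f0: "f i 0 = 0" for i using f(2)[of i 0 0] by simp
  define V' where "V' = {x \<in> V. f j x = 0}"
  have "nc.subspace V'"
    using insert.prems(3) by (auto simp: V'_def nc.subspace_def f f0)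
  moreover have "g x = 0" if "x \<in> V'" "\<And>i. i \<in> I \<Longrightarrow> f i x = 0" for x
    using insert.prems(4)[of x] that by (auto simp: V'_def)
  ultimately obtain c where c: "\<And>x. x \<in> V' \<Longrightarrow> g x = (\<Sum>i\<in>I. c i * f i x)"
    using insert.IH[of V'] insert.prems(1,2) by blast
  show ?case
  proof (cases "\<exists>x\<in>V. f j x \<noteq> 0")
    case False
    then have "\<forall>x\<in>V. g x = (\<Sum>i\<in>insert j I. c i * f i x)"
      using c insert.hyps by (auto simp: V'_def)
    then show ?thesis by blast
  next
    case True
    then obtain z where z: "z \<in> V" "f j z \<noteq> 0" by blast
    \<comment> \<open>With \<open>f j y = 1\<close>, the vector
      \<open>x - nc_scale (f j x) y\<close> lies in \<open>V'\<close>; evaluating the desired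
      identity at \<open>y\<close> forces the coefficient of \<open>j\<close> in
      \<open>c'\<close>.\<close>
    define y where "y = nc_scale (1 / f j z) z"
    have y: "y \<in> V" "f j y = 1"
      using z insert.prems(3) by (auto simp: y_def f nc.subspace_scale)
    define c' where "c' = c(j := g y - (\<Sum>i\<in>I. c i * f i y))"
    have "g x = (\<Sum>i\<in>insert j I. c' i * f i x)" if x: "x \<in> V" for x
    proof -
      have "x - nc_scale (f j x) y \<in> V'"
        using x y insert.prems(3) by (auto simp: V'_def f fdiff nc.subspace_scale nc.subspace_diff)
      from c[OF this] have "g x = f j x * g y + (\<Sum>i\<in>I. c i * f i x - c i * (f j x * f i y))"
        by (simp add: f(2) fdiff g right_diff_distrib diff_eq_eq add.commute)
      also have "(\<Sum>i\<in>I. c i * f i x - c i * (f j x * f i y)) =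
          (\<Sum>i\<in>I. c i * f i x) - f j x * (\<Sum>i\<in>I. c i * f i y)"
        unfolding sum_subtractf sum_distrib_left by (simp only: mult.left_commute[of "f j x"])
      also have "f j x * g y + \<dots> = f j x * (g y - (\<Sum>i\<in>I. c i * f i y)) + (\<Sum>i\<in>I. c i * f i x)"
        by (simp add: right_diff_distrib)
      also have "(\<Sum>i\<in>I. c i * f i x) = (\<Sum>i\<in>I. c' i * f i x)"
        using insert.hyps by (intro sum.cong) (auto simp: c'_def)
      finally show ?thesis using insert.hyps by (simp add: c'_def mult.commute)
    qed
    then show ?thesis by blast
  qed
qed

lemma coset_eq_iff:
  assumes W: "nc.subspace W"
  shows "coset W p = coset W q \<longleftrightarrow> p - q \<in> W"
proof
  assume "coset W p = coset W q"
  moreover have "p \<in> coset W p"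
    using nc.subspace_0[OF W] by (force simp: coset_def)
  ultimately have "p \<in> coset W q" by simp
  then show "p - q \<in> W" by (auto simp: coset_def)
next
  assume pq: "p - q \<in> W"
  have "coset W a \<subseteq> coset W b" if "a - b \<in> W" for a b
  proof
    fix z assume "z \<in> coset W a"
    then obtain w where "w \<in> W" "z = b + ((a - b) + w)"
      by (auto simp: coset_def)
    then show "z \<in> coset W b"
      using that nc.subspace_add[OF W] unfolding coset_def by blast
  qed
  moreover have "q - p \<in> W" using nc.subspace_neg[OF W pq] by simp
  ultimately show "coset W p = coset W q" using pq by blast
qed

text \<open>Trades spanning sets of cosets for sets of representatives chosen in \<open>U\<close>,
  so that quotients by different subspaces can be compared on the same \<open>R\<close>.\<close>

lemma quot_spanning_iff:
  assumes W: "nc.subspace W" and UV: "coset W ` U = coset W ` V"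
  shows "(\<exists>C \<subseteq> quot_space V W. finite C \<and> card C = d \<and> quot_span W C = quot_space V W) \<longleftrightarrow>
    (\<exists>R \<subseteq> U. finite R \<and> card R = d \<and> inj_on (coset W) R \<and> coset W ` nc.span R = coset W ` U)"
    (is "?l \<longleftrightarrow> ?r")
proof -
  have qs: "quot_space V W = coset W ` U" by (auto simp: quot_space_def UV)
  show ?thesis
  proof
    assume ?l
    then obtain C where C: "C \<subseteq> coset W ` U" "finite C" "card C = d" "quot_span W C = coset W ` U"
      unfolding qs by blast
    then obtain R where R: "R \<subseteq> U" "inj_on (coset W) R" "C = coset W ` R"
      by (metis subset_image_inj)
    with C show ?r
      by (intro exI[of _ R])
        (auto simp: card_image quot_span_cosets[OF W] dest: finite_imageD)
  next
    assume ?r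
    then obtain R where "R \<subseteq> U" "finite R" "card R = d" "inj_on (coset W) R"
      "coset W ` nc.span R = coset W ` U" by blast
    then show ?l unfolding qs
      by (intro exI[of _ "coset W ` R"]) (auto simp: card_image quot_span_cosets[OF W])
  qed
qed

text \<open>Two elements of \<open>V\<close> are congruent modulo \<open>K\<close> iff they are
  congruent modulo \<open>V \<inter> K\<close>, so the same sets of representatives in
  \<open>V\<close> compete in both minima.\<close>

lemma quot_dim_second_isomorphism:
  assumes V: "nc.subspace V" and K: "nc.subspace K"
  shows "quot_dim {v + w | v w. v \<in> V \<and> w \<in> K} K = quot_dim V (V \<inter> K)"
proof -
  let ?S = "{v + w | v w. v \<in> V \<and> w \<in> K}"
  have N: "nc.subspace (V \<inter> K)" using V K by (rule nc.subspace_inter)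
  have eq: "coset K p = coset K q \<longleftrightarrow> coset (V \<inter> K) p = coset (V \<inter> K) q"
    if "p \<in> V" "q \<in> V" for p q
    using that nc.subspace_diff[OF V] by (simp add: coset_eq_iff[OF K] coset_eq_iff[OF N])
  have UV: "coset K ` V = coset K ` ?S"
  proof (intro equalityI subsetI)
    fix P assume "P \<in> coset K ` V"
    then obtain v where "v \<in> V" "P = coset K v" by blast
    moreover from this have "v + 0 \<in> ?S" using nc.subspace_0[OF K] by blast
    ultimately show "P \<in> coset K ` ?S" by auto
  next
    fix P assume "P \<in> coset K ` ?S"
    then obtain v w where "v \<in> V" "w \<in> K" "P = coset K (v + w)" by blast
    then show "P \<in> coset K ` V"
      by (intro image_eqI[of _ _ v]) (auto simp: coset_eq_iff[OF K])
  qed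
  \<comment> \<open>Surjectivity is restated through equalities of cosets of elements of
    \<open>V\<close>, the form to which \<open>eq\<close> applies.\<close>
  have im: "h ` A = h ` V \<longleftrightarrow> (\<forall>v\<in>V. \<exists>a\<in>A. h v = h a)" if "A \<subseteq> V"
    for h :: "'a nc_poly \<Rightarrow> 'a nc_poly set" and A
  proof -
    have "h ` A = h ` V \<longleftrightarrow> h ` V \<subseteq> h ` A" using that by blast
    then show ?thesis by (simp add: image_subset_iff image_iff)
  qed
  have "inj_on (coset K) R \<and> coset K ` nc.span R = coset K ` V \<longleftrightarrow>
        inj_on (coset (V \<inter> K)) R \<and> coset (V \<inter> K) ` nc.span R = coset (V \<inter> K) ` V"
    if "R \<subseteq> V" for R
  proof -
    have sp: "nc.span R \<subseteq> V" using that V by (rule nc.span_minimal)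
    have "inj_on (coset K) R \<longleftrightarrow> inj_on (coset (V \<inter> K)) R"
      unfolding inj_on_def using that by (intro ball_cong refl) (simp add: eq subset_iff)
    moreover have "coset K ` nc.span R = coset K ` V \<longleftrightarrow>
        coset (V \<inter> K) ` nc.span R = coset (V \<inter> K) ` V"
      unfolding im[OF sp]
      by (rule ball_cong[OF refl], rule bex_cong[OF refl], rule eq, assumption, rule subsetD[OF sp])
    ultimately show ?thesis by simp
  qed
  then show ?thesis
    unfolding quot_dim_def quot_spanning_iff[OF K UV] quot_spanning_iff[OF N refl]
    by (simp cong: conj_cong)
qed

section \<open>Words and truncation by degree\<close>

definition word_poly :: "'n nc_word \<Rightarrow> 'n nc_poly" where
  "word_poly w = Poly_Mapping.single w 1"

text \<open>The projection onto \<open>V_deg d\<close> along longer words. It extends functionals to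
  the whole algebra, and \<open>p - trunc (m - 1) p\<close> is the tip of
  \<open>p \<in> V_deg m\<close> when \<open>1 \<le> m\<close>.\<close>

definition trunc :: "nat \<Rightarrow> 'n nc_poly \<Rightarrow> 'n nc_poly" where
  "trunc d p = Poly_Mapping.mapp (\<lambda>w c. c when length (letters w) \<le> d) p"

lemma lookup_trunc [simp]:
  "Poly_Mapping.lookup (trunc d p) w = (Poly_Mapping.lookup p w when length (letters w) \<le> d)"
  by (auto simp: trunc_def lookup_mapp when_def in_keys_iff)

lemma trunc_0 [simp]: "trunc d 0 = 0"
  by (rule poly_mapping_eqI) simp

lemma trunc_add: "trunc d (p + q) = trunc d p + trunc d q"
  by (rule poly_mapping_eqI) (simp add: lookup_add when_def)

lemma trunc_scale: "trunc d (nc_scale c p) = nc_scale c (trunc d p)"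
  by (rule poly_mapping_eqI) (simp add: when_def)

lemma length_word_star [simp]: "length (letters (word_star w)) = length (letters w)"
  by (simp add: word_star_def)

lemma length_word_plus [simp]: "length (letters (u + v)) = length (letters u) + length (letters v)"
  by (simp add: plus_nc_word_def)

lemma trunc_star: "trunc d (nc_star p) = nc_star (trunc d p)"
  by (rule poly_mapping_eqI) (simp add: when_def)

lemma V_deg_iff: "p \<in> V_deg d \<longleftrightarrow> (\<forall>w. Poly_Mapping.lookup p w \<noteq> 0 \<longrightarrow> length (letters w) \<le> d)"
  by (auto simp: V_deg_eq in_keys_iff)

lemma trunc_in_V_deg: "trunc d p \<in> V_deg d"
  by (simp add: V_deg_iff when_def)

lemma trunc_id: "p \<in> V_deg d \<Longrightarrow> trunc d p = p"
  by (rule poly_mapping_eqI) (auto simp: V_deg_iff when_def)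

lemma subspace_V_deg: "nc.subspace (V_deg d)"
  by (simp add: V_deg_def)

lemma V_deg_mono: "d \<le> e \<Longrightarrow> V_deg d \<subseteq> V_deg e"
  by (force simp: V_deg_eq)

lemma word_poly_in_V_deg [simp]: "word_poly w \<in> V_deg d \<longleftrightarrow> length (letters w) \<le> d"
  by (simp add: V_deg_eq word_poly_def)

lemma star_in_V_deg [simp]: "nc_star p \<in> V_deg d \<longleftrightarrow> p \<in> V_deg d"
  unfolding V_deg_iff by (metis complex_cnj_zero_iff length_word_star lookup_nc_star word_star_word_star)

lemma mult_in_V_deg:
  assumes "p \<in> V_deg d" "q \<in> V_deg e"
  shows "p * q \<in> V_deg (d + e)"
  using assms keys_mult[of p q] by (fastforce simp: V_deg_eq)

lemma word_poly_plus: "word_poly (u + v) = word_poly u * word_poly v"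
  by (simp add: word_poly_def mult_single)

lemma star_word_poly [simp]: "nc_star (word_poly w) = word_poly (word_star w)"
  by (simp add: word_poly_def nc_star_single)

lemma S_deg_eq_image: "S_deg d = word_poly ` {w. length (letters w) \<le> d}"
  by (auto simp: S_deg_def word_poly_def)

lemma inj_word_poly: "inj word_poly"
  by (rule injI) (metis keys_single word_poly_def singleton_inject zero_neq_one)

text \<open>Scaling is left multiplication by the constant \<open>c\<close> at the empty word, so
  this is associativity.\<close>

lemma scale_mult_left: "nc_scale c p * q = nc_scale c (p * q)"
proof -
  have s: "nc_scale c p = Poly_Mapping.single 0 c * p" for p :: "'a nc_poly"
  proof (induction p rule: update_induct)
    case const
    show ?case by simp
  next
    case (update p a b)
    have "Poly_Mapping.update a b p = Poly_Mapping.single a b + p"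
      using update(1) by (intro poly_mapping_eqI)
        (auto simp: lookup_update lookup_add lookup_single when_def in_keys_iff)
    moreover have "nc_scale c (Poly_Mapping.single a b) = Poly_Mapping.single a (c * b)"
      by (rule poly_mapping_eqI) (simp add: lookup_single when_def)
    ultimately show ?case
      using update(3) by (simp add: nc.scale_right_distrib distrib_left mult_single)
  qed
  show ?thesis by (simp add: s mult.assoc)
qed

lemma independent_word_poly: "nc.independent (range (word_poly :: 'n nc_word \<Rightarrow> _))"
proof
  assume "nc.dependent (range (word_poly :: 'n nc_word \<Rightarrow> _))"
  then obtain w :: "'n nc_word" where "word_poly w \<in> nc.span (range word_poly - {word_poly w})"
    by (auto simp: nc.dependent_def)
  also have "range word_poly - {word_poly w} = (\<lambda>v. Poly_Mapping.single v 1) ` (UNIV - {w})"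
    using inj_word_poly by (auto simp: word_poly_def inj_def)
  finally have "word_poly w \<in> {p. Poly_Mapping.keys p \<subseteq> UNIV - {w}}"
    unfolding span_singles .
  then show False by (simp add: word_poly_def)
qed

lemma finite_words:
  "finite {w :: 'n::finite nc_word. length (letters w) \<le> d}"
proof -
  have "l \<in> range X \<union> range Xstar" for l :: "'n letter"
    by (cases l) auto
  then have "(UNIV :: 'n letter set) = range X \<union> range Xstar" by blast
  then have "finite (UNIV :: 'n letter set)" by (metis finite finite_UnI finite_imageI)
  then have "finite (Word ` {xs :: 'n letter list. set xs \<subseteq> UNIV \<and> length xs \<le> d})"
    by (intro finite_imageI finite_lists_length_le)
  moreover have "{w :: 'n nc_word. length (letters w) \<le> d} \<subseteq> Word ` {xs. set xs \<subseteq> UNIV \<and> length xs \<le> d}"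
    by (auto simp: image_iff intro: nc_word.collapse[symmetric])
  ultimately show ?thesis by (rule rev_finite_subset)
qed

text \<open>Hermitian symmetry stands in for conjugate linearity in the second argument: extend from
  words in the first argument, swap the arguments, and extend again.\<close>

lemma hermitian_forms_eq:
  fixes F G :: "'n nc_poly \<Rightarrow> 'n nc_poly \<Rightarrow> complex"
  assumes lin: "\<And>q. Vector_Spaces.linear nc_scale (*) (\<lambda>p. F p q)"
      "\<And>q. Vector_Spaces.linear nc_scale (*) (\<lambda>p. G p q)"
    and herm: "\<And>p q. p \<in> V_deg d \<Longrightarrow> q \<in> V_deg d \<Longrightarrow> F p q = cnj (F q p)"
      "\<And>p q. p \<in> V_deg d \<Longrightarrow> q \<in> V_deg d \<Longrightarrow> G p q = cnj (G q p)"
    and eq: "\<And>u v. length (letters u) \<le> d \<Longrightarrow> length (letters v) \<le> d \<Longrightarrow> F (word_poly u) (word_poly v) = G (word_poly u) (word_poly v)"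
    and pq: "p \<in> V_deg d" "q \<in> V_deg d"
  shows "F p q = G p q"
proof -
  have S: "b \<in> V_deg d" if "b \<in> S_deg d" for b :: "'n nc_poly"
    using that by (simp add: V_deg_def nc.span_base)
  have 1: "F p b = G p b" if "p \<in> V_deg d" "b \<in> S_deg d" for p b
    by (rule nc_dual.linear_eq_on[OF lin, of p "S_deg d"])
      (use that in \<open>auto simp: V_deg_def S_deg_eq_image eq\<close>)
  have "F q p = G q p"
  proof (rule nc_dual.linear_eq_on[OF lin])
    show "q \<in> nc.span (S_deg d)" using pq by (simp add: V_deg_def)
    show "F b p = G b p" if "b \<in> S_deg d" for b
      using herm(1)[OF S[OF that] pq(1)] herm(2)[OF S[OF that] pq(1)] 1[OF pq(1) that] by simp
  qed
  then show ?thesis using pq by (metis herm)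
qed

section \<open>Extending the functional\<close>

text \<open>Riesz representation for a possibly degenerate hermitian form: a functional that kills
  the radical is a combination of pairings with words of length at most \<open>m\<close>.\<close>

lemma gram_representation:
  fixes L :: "'n::finite nc_poly \<Rightarrow> complex"
  assumes lin: "Vector_Spaces.linear nc_scale (*) L" and herm: "\<And>a. L (nc_star a) = cnj (L a)"
    and g: "Vector_Spaces.linear nc_scale (*) g"
    and van: "\<And>p. p \<in> V_deg m \<Longrightarrow> (\<And>q. q \<in> V_deg m \<Longrightarrow> L (p * nc_star q) = 0) \<Longrightarrow> g p = 0"
  obtains s where "s \<in> V_deg m" "\<And>q. q \<in> V_deg m \<Longrightarrow> g q = L (q * nc_star s)"
proof -
  define I where "I = {w :: 'n nc_word. length (letters w) \<le> m}"
  have right: "L (p * nc_star q) = cnj (L (q * nc_star p))" for p q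
    using herm[of "q * nc_star p"] by (simp add: nc_star_mult)
  have lin1: "Vector_Spaces.linear nc_scale (*) (\<lambda>p. L (p * nc_star q))" for q
    using lin by (simp add: linear_functional_iff distrib_right scale_mult_left)
  have "\<exists>c. \<forall>x\<in>V_deg m. g x = (\<Sum>w\<in>I. c w * L (x * nc_star (word_poly w)))"
  proof (rule functional_combination[OF _ lin1 g subspace_V_deg])
    show "finite I" by (simp add: I_def finite_words)
    fix x :: "'n nc_poly" assume x: "x \<in> V_deg m" and 0: "\<And>w. w \<in> I \<Longrightarrow> L (x * nc_star (word_poly w)) = 0"
    \<comment> \<open>The arguments are swapped so that the form is linear in \<open>q\<close> and
      vanishing on words spreads to their span.\<close>
    have "L (q * nc_star x) = 0" if "q \<in> V_deg m" for q
    proof (rule nc_dual.linear_eq_on[OF lin1 nc_dual.linear_zero])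
      show "q \<in> nc.span (S_deg m)" using that by (simp add: V_deg_def)
      show "L (b * nc_star x) = 0" if "b \<in> S_deg m" for b
        using that 0 right[of b x] by (auto simp: S_deg_eq_image I_def)
    qed
    then show "g x = 0" by (intro van[OF x]) (simp add: right[of x])
  qed
  then obtain c where c: "\<And>x. x \<in> V_deg m \<Longrightarrow> g x = (\<Sum>w\<in>I. c w * L (x * nc_star (word_poly w)))"
    by blast
  \<comment> \<open>The coefficients are conjugated because \<open>s\<close> enters the form through
    \<open>nc_star\<close>.\<close>
  define s where "s = (\<Sum>w\<in>I. nc_scale (cnj (c w)) (word_poly w))"
  show ?thesis
  proof
    show "s \<in> V_deg m" unfolding s_def
      by (intro nc.subspace_sum[OF subspace_V_deg] nc.subspace_scale[OF subspace_V_deg]) (simp add: I_def)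
    fix q :: "'n nc_poly" assume "q \<in> V_deg m"
    have "L (s * nc_star q) = (\<Sum>w\<in>I. cnj (c w) * L (word_poly w * nc_star q))"
      unfolding s_def
      by (simp add: nc_dual.linear_sum[OF lin1] nc_dual.linear_scale[OF lin1])
    then show "g q = L (q * nc_star s)"
      by (simp add: c \<open>q \<in> V_deg m\<close> right[of q] del: star_word_poly)
  qed
qed

text \<open>Right multiplication by a letter, compressed by \<phi>, has as adjoint the compressed
  multiplication by the starred letter. This later lets letters cross the form one at a
  time.\<close>

lemma flat_shift:
  fixes L :: "'n::finite nc_poly \<Rightarrow> complex" and m :: nat
  defines "N \<equiv> {p \<in> V_deg m. \<forall>q\<in>V_deg m. L (p * nc_star q) = 0}"
  assumes m: "1 \<le> m"
    and lin: "Vector_Spaces.linear nc_scale (*) L" and herm: "\<And>a. L (nc_star a) = cnj (L a)"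
    and inj: "inj_on (\<lambda>p. p - trunc (m - 1) p) N"
  obtains \<phi> where "Vector_Spaces.linear nc_scale nc_scale \<phi>"
    "\<And>p. p \<in> V_deg (Suc m) \<Longrightarrow> \<phi> p \<in> V_deg m" "\<And>p. p \<in> V_deg m \<Longrightarrow> \<phi> p = p"
    "\<And>u x v. length (letters u) \<le> m \<Longrightarrow> length (letters v) \<le> m \<Longrightarrow>
       L (\<phi> (word_poly (u + Word [x])) * nc_star (\<phi> (word_poly v))) =
       L (\<phi> (word_poly u) * nc_star (\<phi> (word_poly (v + Word [letter_star x]))))"
proof -
  let ?hi = "\<lambda>p :: 'n nc_poly. p - trunc (m - 1) p"
  have right: "L (p * nc_star q) = cnj (L (q * nc_star p))" for p q
    using herm[of "q * nc_star p"] by (simp add: nc_star_mult)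
  have lin1: "Vector_Spaces.linear nc_scale (*) (\<lambda>p. L (p * q))" for q
    using lin by (simp add: linear_functional_iff distrib_right scale_mult_left)
  note L_add = nc_dual.linear_add[OF lin] and L_diff = nc_dual.linear_diff[OF lin]
    and L_scale = nc_dual.linear_scale[OF lin] and L_0 = nc_dual.linear_0[OF lin]
  have subN: "nc.subspace N"
    using subspace_V_deg[of m, where 'a = 'n] unfolding N_def
    by (auto simp: nc.subspace_def distrib_right scale_mult_left L_add L_scale L_0)
  have hi: "Vector_Spaces.linear nc_scale nc_scale ?hi"
    by (simp add: linear_endo_iff trunc_add trunc_scale nc.scale_right_diff_distrib)
  \<comment> \<open>\<open>g\<close> recovers an element of \<open>N\<close> from its top-degree
    part; injectivity of the tip on \<open>N\<close> is what makes this possible. Subtracting its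
    value gives \<open>E\<close>, which fixes \<open>V_deg (m - 1)\<close> because the top part
    there is \<open>0\<close>.\<close>
  obtain g where g: "range g \<subseteq> N" "Vector_Spaces.linear nc_scale nc_scale g"
    "\<And>p. p \<in> N \<Longrightarrow> g (?hi p) = p"
    using nc_endo.linear_exists_left_inverse_on[OF hi subN inj] by blast
  define E where "E p = p - g (?hi p)" for p
  define lo where "lo p = trunc (m - 1) (E p)" for p
  have E_lin: "E (p + q) = E p + E q" "E (nc_scale c p) = nc_scale c (E p)" for p q c
    unfolding E_def nc_endo.linear_add[OF hi] nc_endo.linear_add[OF g(2)]
      nc_endo.linear_scale[OF hi] nc_endo.linear_scale[OF g(2)]
    by (simp_all add: nc.scale_right_diff_distrib)
  have lo_lin: "lo (p + q) = lo p + lo q" "lo (nc_scale c p) = nc_scale c (lo p)" for p q c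
    by (simp_all add: lo_def E_lin trunc_add trunc_scale)
  have gN: "g p \<in> N" for p using g(1) by blast
  have E_V: "E p \<in> V_deg m" if "p \<in> V_deg m" for p
    unfolding E_def using that gN[of "?hi p"]
    by (intro nc.subspace_diff[OF subspace_V_deg]) (simp_all add: N_def)
  have E_form: "L (E p * nc_star q) = L (p * nc_star q)" if "q \<in> V_deg m" for p q
    using gN[of "?hi p"] that by (simp add: E_def left_diff_distrib L_diff N_def)
  have lo_V: "lo p \<in> V_deg (m - 1)" for p by (simp add: lo_def trunc_in_V_deg)
  have E_id: "E p = p" "lo p = p" if "p \<in> V_deg (m - 1)" for p
    using that by (simp_all add: E_def lo_def trunc_id nc_endo.linear_0[OF g(2)])
  have E_N: "E p = 0" "lo p = 0" if "p \<in> N" for p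
    using that g(3) by (simp_all add: E_def lo_def)
  define Y where "Y x = word_poly (Word [x])" for x :: "'n letter"
  have Y_star: "nc_star (Y x) = Y (letter_star x)" for x
    by (simp add: Y_def word_star_def)
  \<comment> \<open>The value of \<open>u x v\<^sup>*\<close> after replacing \<open>u, v\<close> by \<open>E u, E v\<close>; the summand
    \<open>(E u - lo u) x (E v - lo v)\<^sup>*\<close> of degree \<open>2m + 1\<close>, where \<open>L\<close> is not prescribed, is given the value \<open>0\<close>.\<close>
  define G where "G x u v = L (E u * (Y x * nc_star (lo v))) + L (lo u * (Y x * nc_star (E v)))
    - L (lo u * (Y x * nc_star (lo v)))" for x u v
  have shift: "L (p * (Y x * nc_star q)) = cnj (L (q * (Y (letter_star x) * nc_star p)))" for p q x
    using herm[of "q * (Y (letter_star x) * nc_star p)"] by (simp add: nc_star_mult Y_star mult.assoc)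
  \<comment> \<open>Conjugation exchanges the first two summands of \<open>G\<close> and preserves
    the third.\<close>
  have G_sym: "G x u v = cnj (G (letter_star x) v u)" for x u v
    by (simp add: G_def shift[of _ x])
  have G_lin: "Vector_Spaces.linear nc_scale (*) (\<lambda>u. G x u v)" for x v
    by (simp add: linear_functional_iff G_def E_lin lo_lin distrib_right scale_mult_left
        L_add L_scale algebra_simps)
  have G_N: "G x u v = 0" if "u \<in> N" for x u v
    using that by (simp add: G_def E_N L_0)
  \<comment> \<open>Here \<open>E u = lo u = u\<close>, so the first and third summands cancel. In
    the second, \<open>E v\<close> may be replaced by \<open>v\<close>, since they differ by an
    element of \<open>N\<close> and \<open>u * Y x\<close> still lies in
    \<open>V_deg m\<close>.\<close>
  have G_low: "G x u v = L (u * Y x * nc_star v)" if u: "u \<in> V_deg (m - 1)" and v: "v \<in> V_deg m" for x u v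
  proof -
    have "u * Y x \<in> V_deg (m - 1 + 1)"
      using u by (intro mult_in_V_deg) (auto simp: Y_def)
    then have uY: "u * Y x \<in> V_deg m" using m by simp
    have "G x u v = L (u * Y x * nc_star (E v))"
      using u by (simp add: G_def E_id mult.assoc)
    also have "\<dots> = L (u * Y x * nc_star v)"
      using E_form[OF uY] by (simp add: right[of "u * Y x"])
    finally show ?thesis .
  qed
  \<comment> \<open>The representation lemma works in the first argument, so it is applied to
    \<open>G (letter_star x) q u\<close> as a functional of \<open>q\<close>, and
    \<open>G_sym\<close> turns the result around.\<close>
  have repr: "\<exists>s\<in>V_deg m. \<forall>q\<in>V_deg m. L (s * nc_star q) = G x u q" for x u
  proof -
    obtain s where s: "s \<in> V_deg m" "\<And>q. q \<in> V_deg m \<Longrightarrow> G (letter_star x) q u = L (q * nc_star s)"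
      by (rule gram_representation[OF lin herm G_lin, of m "letter_star x" u])
        (auto intro: G_N simp: N_def)
    then show ?thesis
      by (intro bexI[of _ s]) (auto simp: right[of s] G_sym[of x])
  qed
  \<comment> \<open>Words of length at most \<open>m\<close> stay fixed, consistently with
    \<open>G\<close> by \<open>G_low\<close>. A longer word has a unique last letter, so its image
    can be taken from \<open>repr\<close>.\<close>
  have "\<exists>s. (length (letters w) \<le> Suc m \<longrightarrow> s \<in> V_deg m) \<and> (length (letters w) \<le> m \<longrightarrow> s = word_poly w) \<and>
    (\<forall>u x. w = u + Word [x] \<and> length (letters u) \<le> m \<longrightarrow> (\<forall>q\<in>V_deg m. L (s * nc_star q) = G x (word_poly u) q))"
    for w :: "'n nc_word"
  proof (cases "length (letters w) \<le> m")
    case True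
    have "L (word_poly w * nc_star q) = G x (word_poly u) q" if "w = u + Word [x]" "q \<in> V_deg m" for u x q
      using True that by (subst G_low) (auto simp: Y_def word_poly_plus)
    with True show ?thesis by (intro exI[of _ "word_poly w"]) auto
  next
    case False
    then obtain xs x where "letters w = xs @ [x]" by (cases "letters w" rule: rev_cases) auto
    then have w: "w = Word xs + Word [x]" by (cases w) (simp add: plus_nc_word_def)
    obtain s where s: "s \<in> V_deg m" "\<forall>q\<in>V_deg m. L (s * nc_star q) = G x (word_poly (Word xs)) q"
      using repr by blast
    have "u = Word xs \<and> y = x" if "w = u + Word [y]" for u y
      using that w by (cases u) (simp add: plus_nc_word_def)
    with False s show ?thesis by (intro exI[of _ s]) auto
  qed
  then obtain \<psi> where \<psi>: "\<And>w. length (letters w) \<le> Suc m \<Longrightarrow> \<psi> w \<in> V_deg m"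
    "\<And>w. length (letters w) \<le> m \<Longrightarrow> \<psi> w = word_poly w"
    "\<And>u x q. length (letters u) \<le> m \<Longrightarrow> q \<in> V_deg m \<Longrightarrow> L (\<psi> (u + Word [x]) * nc_star q) = G x (word_poly u) q"
    by metis
  obtain \<phi> where \<phi>: "Vector_Spaces.linear nc_scale nc_scale \<phi>" "\<And>w. \<phi> (word_poly w) = \<psi> w"
    using nc_endo.linear_independent_extend[OF independent_word_poly, of "\<psi> \<circ> inv word_poly"]
    by (auto simp: inv_f_f[OF inj_word_poly])
  show ?thesis
  proof
    show "Vector_Spaces.linear nc_scale nc_scale \<phi>" by (rule \<phi>(1))
    show "\<phi> p \<in> V_deg m" if "p \<in> V_deg (Suc m)" for p
    proof -
      have "\<phi> ` S_deg (Suc m) \<subseteq> V_deg m" by (auto simp: S_deg_eq_image \<phi>(2) \<psi>(1))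
      then have "\<phi> ` V_deg (Suc m) \<subseteq> V_deg m"
        unfolding V_deg_def[of "Suc m"] nc_endo.linear_span_image[OF \<phi>(1), symmetric]
        by (rule nc.span_minimal) (rule subspace_V_deg)
      then show ?thesis using that by blast
    qed
    show "\<phi> p = p" if "p \<in> V_deg m" for p
      using that by (intro nc_endo.linear_eq_on[OF \<phi>(1) nc.linear_ident, of p "S_deg m"])
        (auto simp: V_deg_def S_deg_eq_image \<phi>(2) \<psi>(2))
    fix u v :: "'n nc_word" and x
    assume "length (letters u) \<le> m" "length (letters v) \<le> m"
    \<comment> \<open>Both sides equal \<open>G x (word_poly u) (word_poly v)\<close>, the right one
      by \<open>G_sym\<close>.\<close>
    then show "L (\<phi> (word_poly (u + Word [x])) * nc_star (\<phi> (word_poly v))) =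
       L (\<phi> (word_poly u) * nc_star (\<phi> (word_poly (v + Word [letter_star x]))))"
      by (simp add: \<phi>(2) \<psi>(2,3) right[of "word_poly u"] G_sym[of x] del: star_word_poly)
  qed
qed

section \<open>Assembling the extension from the retraction\<close>

lemma word_halves:
  fixes w :: "'n nc_word"
  assumes "length (letters w) \<le> 2 * d"
  obtains u v where "w = u + word_star v" "length (letters u) \<le> d" "length (letters v) \<le> d"
proof
  let ?u = "Word (take d (letters w))" and ?v = "Word (drop d (letters w))"
  show "w = ?u + word_star (word_star ?v)" by (simp add: plus_nc_word_def)
  show "length (letters ?u) \<le> d" "length (letters (word_star ?v)) \<le> d" using assms by auto
qed

theorem lemma14:
  fixes k :: nat and L :: "'n::finite nc_poly \<Rightarrow> complex"
  assumes "2 \<le> k"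
    and "L \<in> dual_deg (2 * k - 2)"
    and "tip_maximal (k - 1) L"
  shows "\<exists>Lk \<in> dual_deg (2 * k).
           restrict Lk (V_deg (2 * k - 2)) = L \<and> flat k Lk \<and>
           (positive_semidefinite (k - 1) L \<longrightarrow> positive_semidefinite k Lk)"
proof -
  define m where "m = k - 1"
  have k: "k = Suc m" and m: "1 \<le> m" and km: "2 * k - 2 = 2 * m" "k - 1 = m"
    using assms(1) by (auto simp: m_def)
  have dual: "L \<in> dual_deg (2 * m)" and tip: "tip_maximal m L"
    using assms(2,3) unfolding km .
  \<comment> \<open>Elements of \<^const>\<open>dual_deg\<close> are junk outside \<open>V_deg (2 * m)\<close>; \<open>M\<close> is linear on the whole algebra.\<close>
  define M where "M p = L (trunc (2 * m) p)" for p
  have M_L: "M p = L p" if "p \<in> V_deg (2 * m)" for p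
    using that by (simp add: M_def trunc_id)
  have lin: "Vector_Spaces.linear nc_scale (*) M"
    using dual by (simp add: linear_functional_iff M_def trunc_add trunc_scale dual_deg_def trunc_in_V_deg)
  have herm: "M (nc_star a) = cnj (M a)" for a
    using tip by (simp add: M_def trunc_star tip_maximal_def hermitian_def trunc_in_V_deg)
  have in2: "p * nc_star q \<in> V_deg (2 * d)" if "p \<in> V_deg d" "q \<in> V_deg d" for p q :: "'n nc_poly" and d
    using mult_in_V_deg[of p d "nc_star q" d] that by (simp add: mult_2)
  define N where "N = {p \<in> V_deg m. \<forall>q\<in>V_deg m. M (p * nc_star q) = 0}"
  have ker: "ker_B m L = N"
    by (auto simp: ker_B_def N_def B_form_def M_L in2)
  \<comment> \<open>On \<open>P\<close> the tip is the linear map \<open>?hi\<close>; being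
    injective on \<open>P\<close> with independent image, it is injective on the span
    \<open>N\<close>.\<close>
  have inj: "inj_on (\<lambda>p. p - trunc (m - 1) p) N"
  proof -
    let ?hi = "\<lambda>p :: 'n nc_poly. p - trunc (m - 1) p"
    obtain P where P: "nc.span P = N" "inj_on (tip m) P" "nc.independent (tip m ` P)"
      using tip by (auto simp: tip_maximal_def ker)
    have "tip m p = ?hi p" if "p \<in> P" for p
    proof (rule poly_mapping_eqI)
      fix w
      have "p \<in> N" using nc.span_base[OF that] P(1) by simp
      then have p: "p \<in> V_deg m" by (simp add: N_def)
      then show "Poly_Mapping.lookup (tip m p) w = Poly_Mapping.lookup (?hi p) w"
        using m by (auto simp: lookup_tip[OF m p] lookup_minus when_def V_deg_iff)
    qed
    then have "inj_on ?hi P" "nc.independent (?hi ` P)"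
      using P(2,3) by (simp_all cong: inj_on_cong image_cong)
    moreover have "Vector_Spaces.linear nc_scale nc_scale ?hi"
      by (simp add: linear_endo_iff trunc_add trunc_scale nc.scale_right_diff_distrib)
    ultimately show ?thesis
      using nc_endo.linear_inj_on_span_independent_image[of ?hi P] P(1) by simp
  qed
  obtain \<phi> where \<phi>: "Vector_Spaces.linear nc_scale nc_scale \<phi>"
    "\<And>p. p \<in> V_deg k \<Longrightarrow> \<phi> p \<in> V_deg m" "\<And>p. p \<in> V_deg m \<Longrightarrow> \<phi> p = p"
    "\<And>u x v. length (letters u) \<le> m \<Longrightarrow> length (letters v) \<le> m \<Longrightarrow>
       M (\<phi> (word_poly (u + Word [x])) * nc_star (\<phi> (word_poly v))) =
       M (\<phi> (word_poly u) * nc_star (\<phi> (word_poly (v + Word [letter_star x]))))"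
    by (rule flat_shift[OF m lin herm inj[unfolded N_def], folded k]) blast
  define D where "D p q = M (\<phi> p * nc_star (\<phi> q))" for p q
  have D_lin: "Vector_Spaces.linear nc_scale (*) (\<lambda>p. D p q)" for q
    by (simp add: linear_functional_iff D_def nc_endo.linear_add[OF \<phi>(1)] nc_endo.linear_scale[OF \<phi>(1)]
        distrib_right scale_mult_left nc_dual.linear_add[OF lin] nc_dual.linear_scale[OF lin])
  have D_sym: "D p q = cnj (D q p)" for p q
    using herm[of "\<phi> q * nc_star (\<phi> p)"] by (simp add: D_def nc_star_mult)
  \<comment> \<open>The value of the extension on a word, read off from the cut after
    \<open>k\<close> letters; \<open>split\<close> shows that every admissible cut gives the same
    value.\<close>
  define e where "e w = D (word_poly (Word (take k (letters w)))) (word_poly (word_star (Word (drop k (letters w)))))"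
    for w
  obtain \<Lambda> where \<Lambda>: "Vector_Spaces.linear nc_scale (*) \<Lambda>" "\<And>w. \<Lambda> (word_poly w) = e w"
    using nc_dual.linear_independent_extend[OF independent_word_poly, of "e \<circ> inv word_poly"]
    by (auto simp: inv_f_f[OF inj_word_poly])
  \<comment> \<open>Letters of \<open>ys\<close> cross to the left argument one by one, by the
    adjointness of \<phi>, until \<open>u\<close> reaches length \<open>k\<close> or
    \<open>ys\<close> is empty; then the cut is the one in \<open>e\<close>.\<close>
  have split: "D (word_poly u) (word_poly (word_star (Word ys))) = e (u + Word ys)"
    if "length (letters u) \<le> k" "length ys \<le> k" for u :: "'n nc_word" and ys
    using that
  proof (induction ys arbitrary: u)
    case Nil
    then show ?case by (simp add: e_def plus_nc_word_def)
  next
    case (Cons y ys)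
    show ?case
    proof (cases "length (letters u) = k")
      case True
      then show ?thesis by (simp add: e_def plus_nc_word_def)
    next
      case False
      have "word_star (Word (y # ys)) = word_star (Word ys) + Word [letter_star y]"
        by (simp add: word_star_def plus_nc_word_def)
      moreover have "D (word_poly (u + Word [y])) (word_poly (word_star (Word ys))) =
          D (word_poly u) (word_poly (word_star (Word ys) + Word [letter_star y]))"
        using False Cons.prems unfolding D_def by (intro \<phi>(4)) (auto simp: k)
      moreover have "D (word_poly (u + Word [y])) (word_poly (word_star (Word ys))) = e (u + Word [y] + Word ys)"
        using False Cons.prems by (intro Cons.IH) (auto simp: k)
      moreover have "u + Word [y] + Word ys = u + Word (y # ys)"
        by (simp add: plus_nc_word_def)
      ultimately show ?thesis by simp
    qed
  qed
  have split': "\<Lambda> (word_poly (u + word_star v)) = D (word_poly u) (word_poly v)"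
    if "length (letters u) \<le> k" "length (letters v) \<le> k" for u v :: "'n nc_word"
    using split[of u "letters (word_star v)"] that by (simp add: \<Lambda>(2))
  have \<Lambda>_star: "\<Lambda> (nc_star a) = cnj (\<Lambda> a)" if "a \<in> V_deg (2 * k)" for a
  proof -
    \<comment> \<open>The two conjugations make the left side linear in \<open>a\<close>, so words
      suffice; there the claim is \<open>D_sym\<close> for the two halves.\<close>
    have "cnj (\<Lambda> (nc_star a)) = \<Lambda> a"
    proof (rule nc_dual.linear_eq_on[OF _ \<Lambda>(1)])
      show "Vector_Spaces.linear nc_scale (*) (\<lambda>a. cnj (\<Lambda> (nc_star a)))"
        by (simp add: linear_functional_iff nc_star_add nc_star_scale
            nc_dual.linear_add[OF \<Lambda>(1)] nc_dual.linear_scale[OF \<Lambda>(1)])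
      show "a \<in> nc.span (S_deg (2 * k))" using that by (simp add: V_deg_def)
      fix b :: "'n nc_poly" assume "b \<in> S_deg (2 * k)"
      then obtain w where w: "b = word_poly w" "length (letters w) \<le> 2 * k"
        by (auto simp: S_deg_eq_image)
      then obtain u v where "w = u + word_star v" "length (letters u) \<le> k" "length (letters v) \<le> k"
        by (elim word_halves)
      then show "cnj (\<Lambda> (nc_star b)) = \<Lambda> b"
        using D_sym[of "word_poly u" "word_poly v"] by (simp add: w(1) word_star_plus split')
    qed
    then show ?thesis by (metis complex_cnj_cnj)
  qed
  have \<Lambda>_D: "\<Lambda> (p * nc_star q) = D p q" if "p \<in> V_deg k" "q \<in> V_deg k" for p q
  proof (rule hermitian_forms_eq[where d = k, OF _ D_lin _ D_sym _ that])
    show "Vector_Spaces.linear nc_scale (*) (\<lambda>p. \<Lambda> (p * nc_star q))" for q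
      by (simp add: linear_functional_iff distrib_right scale_mult_left
            nc_dual.linear_add[OF \<Lambda>(1)] nc_dual.linear_scale[OF \<Lambda>(1)])
    show "\<Lambda> (p * nc_star q) = cnj (\<Lambda> (q * nc_star p))" if "p \<in> V_deg k" "q \<in> V_deg k" for p q
      using \<Lambda>_star[OF in2[OF that(2,1)]] by (simp add: nc_star_mult)
    show "\<Lambda> (word_poly u * nc_star (word_poly v)) = D (word_poly u) (word_poly v)"
      if "length (letters u) \<le> k" "length (letters v) \<le> k" for u v
      using split'[OF that] by (simp add: word_poly_plus)
  qed
  have \<Lambda>_L: "\<Lambda> p = L p" if "p \<in> V_deg (2 * m)" for p
  proof -
    have "\<Lambda> p = M p"
    proof (rule nc_dual.linear_eq_on[OF \<Lambda>(1) lin])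
      show "p \<in> nc.span (S_deg (2 * m))" using that by (simp add: V_deg_def)
      fix b :: "'n nc_poly" assume "b \<in> S_deg (2 * m)"
      then obtain w where w: "b = word_poly w" "length (letters w) \<le> 2 * m"
        by (auto simp: S_deg_eq_image)
      then obtain u v where uv: "w = u + word_star v" "length (letters u) \<le> m" "length (letters v) \<le> m"
        by (elim word_halves)
      \<comment> \<open>Both halves lie in \<open>V_deg m\<close>, where \<phi> is the identity, so
        \<open>D\<close> returns the original value.\<close>
      then have "\<Lambda> b = D (word_poly u) (word_poly v)" by (simp add: w(1) split' k)
      also have "\<dots> = M b" using uv by (simp add: D_def \<phi>(3) w(1) word_poly_plus)
      finally show "\<Lambda> b = M b" .
    qed
    with that show ?thesis by (simp add: M_L)
  qed
  define Lk where "Lk = restrict \<Lambda> (V_deg (2 * k))"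
  have Lk: "Lk p = \<Lambda> p" if "p \<in> V_deg (2 * k)" for p using that by (simp add: Lk_def)
  have Lk_dual: "Lk \<in> dual_deg (2 * k)"
    using subspace_V_deg[of "2 * k", where 'a = 'n] nc_dual.linear_add[OF \<Lambda>(1)] nc_dual.linear_scale[OF \<Lambda>(1)]
    by (auto simp: dual_deg_def Lk nc.subspace_add nc.subspace_scale) (simp add: Lk_def)
  have ext: "restrict Lk (V_deg (2 * m)) = L"
  proof
    fix p :: "'n nc_poly"
    show "restrict Lk (V_deg (2 * m)) p = L p"
    proof (cases "p \<in> V_deg (2 * m)")
      case True
      then have "p \<in> V_deg (2 * k)" using V_deg_mono[of "2 * m" "2 * k"] by (auto simp: k)
      with True show ?thesis by (simp add: Lk \<Lambda>_L)
    next
      case False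
      then show ?thesis using dual by (simp add: dual_deg_def extensional_def)
    qed
  qed
  define K where "K = {p \<in> V_deg k. \<forall>q\<in>V_deg k. D p q = 0}"
  have kerK: "ker_B k Lk = K"
    by (auto simp: ker_B_def K_def B_form_def Lk in2 \<Lambda>_D)
  have Vmk: "V_deg m \<subseteq> (V_deg k :: 'n nc_poly set)" by (rule V_deg_mono) (simp add: k)
  have subK: "nc.subspace K"
    using subspace_V_deg[of k, where 'a = 'n]
    by (auto simp: K_def nc.subspace_def nc_dual.linear_0[OF D_lin] nc_dual.linear_add[OF D_lin]
        nc_dual.linear_scale[OF D_lin])
  \<comment> \<open>For \<open>p \<in> N\<close> and \<open>q \<in> V_deg k\<close>,
    \<open>D p q\<close> pairs \<open>p\<close> with \<open>\<phi> q \<in> V_deg m\<close> and so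
    vanishes; conversely, testing against \<open>V_deg m\<close> suffices.\<close>
  have int: "V_deg m \<inter> K = N"
  proof (intro equalityI subsetI)
    fix p assume "p \<in> V_deg m \<inter> K"
    then have p: "p \<in> V_deg m" and "\<And>q. q \<in> V_deg k \<Longrightarrow> D p q = 0" by (auto simp: K_def)
    then have "M (p * nc_star q) = 0" if "q \<in> V_deg m" for q
      using that Vmk \<phi>(3) unfolding D_def by (metis subsetD)
    with p show "p \<in> N" by (simp add: N_def)
  next
    fix p assume "p \<in> N"
    then show "p \<in> V_deg m \<inter> K"
      using Vmk by (auto simp: N_def K_def D_def \<phi>(2,3))
  qed
  \<comment> \<open>As \<phi> is a retraction it kills \<open>p - \<phi> p\<close>, which therefore
    lies in \<open>K\<close>.\<close>
  have sum: "V_deg k = {v + w | v w. v \<in> V_deg m \<and> w \<in> K}"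
  proof (intro equalityI subsetI)
    fix p :: "'n nc_poly" assume p: "p \<in> V_deg k"
    have "p - \<phi> p \<in> V_deg k"
      using p \<phi>(2)[OF p] Vmk by (intro nc.subspace_diff[OF subspace_V_deg]) auto
    moreover have "\<phi> (p - \<phi> p) = 0"
      using p by (simp add: nc_endo.linear_diff[OF \<phi>(1)] \<phi>(2,3))
    ultimately have "p - \<phi> p \<in> K" by (simp add: K_def D_def nc_dual.linear_0[OF lin])
    moreover have "p = \<phi> p + (p - \<phi> p)" by simp
    ultimately show "p \<in> {v + w | v w. v \<in> V_deg m \<and> w \<in> K}" using \<phi>(2)[OF p] by blast
  next
    fix p assume "p \<in> {v + w | v w. v \<in> V_deg m \<and> w \<in> K}"
    then show "p \<in> V_deg k"
      using Vmk by (auto simp: K_def intro!: nc.subspace_add[OF subspace_V_deg])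
  qed
  \<comment> \<open>By \<open>sum\<close> and \<open>int\<close>, the second isomorphism theorem
    identifies the dimension of \<open>V_deg k\<close> modulo \<open>K\<close> with that of
    \<open>V_deg m\<close> modulo \<open>N\<close>.\<close>
  have rank: "rank_B k Lk = rank_B m L"
    using quot_dim_second_isomorphism[OF subspace_V_deg[of m] subK]
    by (simp add: rank_B_def kerK ker int sum[symmetric])
  have "hermitian k Lk" by (simp add: hermitian_def Lk \<Lambda>_star)
  then have "flat k Lk"
    using assms(1) Lk_dual rank unfolding flat_def km ext by simp
  \<comment> \<open>The value at \<open>p * nc_star p\<close> is that of \<open>L\<close> at
    \<open>\<phi> p * nc_star (\<phi> p)\<close>, with
    \<open>\<phi> p \<in> V_deg m\<close>.\<close>
  moreover have "positive_semidefinite k Lk" if "positive_semidefinite m L"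
    using that by (simp add: positive_semidefinite_def Lk in2 \<Lambda>_D D_def \<phi>(2) M_L)
  ultimately show ?thesis
    unfolding km using Lk_dual ext by blast
qed

end
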